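(* Let $m\ge1$ and $N\ge1$ be integers, and consider the misère single-theater escalation game with state space $\{0,1,\dots,N\}$ and escalation set $S=\{1,\dots,m\}$. The status-quo rung $n=0$, i.e. the state $r=N$, is a $\mathcal{P}$-position (for the player to move there, the side contemplating first escalation) if and only if $N\equiv 1\pmod{m+1}$.
   Context: Single-theater escalation game: fix integers $m\ge1$, $N\ge1$. It is a two-player game with alternating turns. The state space is $\{0,1,\dots,N\}$; a state $r$ is the distance to the threshold, and corresponds to the rung $n=N-r$ (so $n=0$ is the status quo and $n=N$ is the threshold). From a state $r\ge1$ the player to move must choose a step $d\in S=\{1,\dots,m\}$ with $d\le r$ and moves to $r-d$ (passing is not allowed). The state $r=0$ is terminal. Under the misère convention the player who moves to $0$ loses. Outcome classes under the misère convention: the terminal state $r=0$ is declared an $\mathcal{N}$-position. For $r\ge1$, recursively, $r$ is a $\mathcal{P}$-position (the player to move loses) if and only if every state reachable by one legal move is an $\mathcal{N}$-position, and $r$ is an $\mathcal{N}$-position if and only if some state reachable by one legal move is a $\mathcal{P}$-position. *)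

theory Defs
  imports "HOL-Number_Theory.Cong"
begin

text \<open>The single-theater escalation game. A state \<open>r\<close> is the distance to the threshold \<open>N\<close>;
  \<open>m\<close> is the largest step. The rules are the same for both players, so a position is
  determined by \<open>r\<close> alone, seen from the player to move.\<close>

definition states :: "nat \<Rightarrow> nat set" where
  "states N = {0..N}"

definition escalation_set :: "nat \<Rightarrow> nat set" where
  "escalation_set m = {1..m}"

definition rung_state :: "nat \<Rightarrow> nat \<Rightarrow> nat" where
  "rung_state N n = N - n"

definition legal_move :: "nat \<Rightarrow> nat \<Rightarrow> nat \<Rightarrow> nat \<Rightarrow> bool" where
  "legal_move m N r r' \<longleftrightarrow>
     r \<in> states N \<and> r \<ge> 1 \<and> (\<exists>d \<in> escalation_set m. d \<le> r \<and> r' = r - d)"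

text \<open>Outcome classes under the misere convention: the player who moves to 0 loses, so the
  terminal state 0 counts as a win for the player to move there. Every move decreases the state,
  so the least fixed point is the recursion on \<open>r\<close>; the recursive equivalences
  are derived below.\<close>

inductive misere_P :: "nat \<Rightarrow> nat \<Rightarrow> nat \<Rightarrow> bool"
  and misere_N :: "nat \<Rightarrow> nat \<Rightarrow> nat \<Rightarrow> bool"
  for m N :: nat
where
  terminal: "misere_N m N 0"
| P_step: "r \<in> states N \<Longrightarrow> r \<ge> 1 \<Longrightarrow> (\<forall>r'. legal_move m N r r' \<longrightarrow> misere_N m N r') \<Longrightarrow> misere_P m N r"
| N_step: "legal_move m N r r' \<Longrightarrow> misere_P m N r' \<Longrightarrow> misere_N m N r"

lemma misere_zero: "misere_N m N 0" "\<not> misere_P m N 0"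
  by (auto intro: terminal elim: misere_P.cases)

lemma misere_P_iff:
  assumes "r \<in> states N" "r \<ge> 1"
  shows "misere_P m N r \<longleftrightarrow> (\<forall>r'. legal_move m N r r' \<longrightarrow> misere_N m N r')"
  using assms by (auto intro: P_step elim: misere_P.cases)

lemma misere_N_iff:
  assumes "r \<in> states N" "r \<ge> 1"
  shows "misere_N m N r \<longleftrightarrow> (\<exists>r'. legal_move m N r r' \<and> misere_P m N r')"
  using assms by (auto intro: N_step elim: misere_N.cases)

lemma misere_P_iff_not_N:
  assumes "r \<in> states N"
  shows "misere_P m N r \<longleftrightarrow> \<not> misere_N m N r"
  using assms
proof (induction r rule: less_induct)
  case (less r)
  show ?case
  proof (cases "r = 0")
    case True
    then show ?thesis by (simp add: misere_zero)
  next
    case False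
    then have r: "r \<ge> 1" by simp
    have "misere_P m N r' \<longleftrightarrow> \<not> misere_N m N r'" if "legal_move m N r r'" for r'
    proof (rule less.IH)
      show "r' < r" "r' \<in> states N"
        using that by (auto simp: legal_move_def states_def escalation_set_def)
    qed
    then show ?thesis
      using misere_P_iff[OF less.prems r] misere_N_iff[OF less.prems r] by blast
  qed
qed

end

theory Submission
  imports Defs
begin

text \<open>
  A player who leaves the opponent at distance 1 from the threshold wins, since the opponent is then
  forced to step onto it. The residue class of 1 modulo \<open>m + 1\<close> extends this target: no single
  step, having size between 1 and \<open>m\<close>, leads from one member of the class to another
  (\<open>no_step_within_residue_one\<close>), while from every other nonzero state some step leads into the
  class (\<open>step_into_residue_one\<close>). Strong induction on the distance then identifies the class with
  the set of \<open>\<P>\<close>-positions (\<open>misere_P_iff_mod_eq_one\<close>). State 0 fits the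
  pattern: it is an \<open>\<N>\<close>-position by convention, and its residue is 0.
\<close>

lemma legal_move_iff:
  assumes "r \<le> N" "r \<ge> 1"
  shows "legal_move m N r r' \<longleftrightarrow> (\<exists>d. 1 \<le> d \<and> d \<le> m \<and> d \<le> r \<and> r' = r - d)"
  using assms by (auto simp: legal_move_def states_def escalation_set_def)

text \<open>Two states with equal residue differ by a multiple of \<open>m + 1\<close>, which exceeds every
  legal step.\<close>

lemma no_step_within_residue_one:
  fixes r d m :: nat
  assumes "r mod (m + 1) = 1" "1 \<le> d" "d \<le> m" "d \<le> r"
  shows "(r - d) mod (m + 1) \<noteq> 1"
proof
  assume "(r - d) mod (m + 1) = 1"
  with assms(1) have "r mod (m + 1) = (r - d) mod (m + 1)" by simp
  then have "(m + 1) dvd r - (r - d)"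
    by (rule mod_eq_dvd_iff_nat[THEN iffD1, rotated]) simp
  with \<open>d \<le> r\<close> have "(m + 1) dvd d" by simp
  with assms(2,3) show False by (auto dest: dvd_imp_le)
qed

text \<open>A residue of at least 2 is lowered to 1 directly. Residue 0 needs the largest step \<open>m\<close>, which
  acts like adding 1 modulo \<open>m + 1\<close>; it is available because a positive multiple of \<open>m + 1\<close> is
  larger than \<open>m\<close>. The condition \<open>m \<ge> 1\<close> guarantees that the residue 1 exists.\<close>

lemma step_into_residue_one:
  fixes r m :: nat
  assumes "m \<ge> 1" "r \<ge> 1" "r mod (m + 1) \<noteq> 1"
  shows "\<exists>d. 1 \<le> d \<and> d \<le> m \<and> d \<le> r \<and> (r - d) mod (m + 1) = 1"
proof -
  define q s where "q = r div (m + 1)" and "s = r mod (m + 1)"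
  have r: "r = q * (m + 1) + s"
    unfolding q_def s_def by (rule div_mult_mod_eq[symmetric])
  have "s \<le> m"
    unfolding s_def using mod_less_divisor[of "m + 1" r] by simp
  show ?thesis
  proof (cases "s = 0")
    case True
    with r \<open>r \<ge> 1\<close> obtain k where "q = Suc k" by (cases q) auto
    with r True have "r - m = k * (m + 1) + 1" and "m \<le> r" by auto
    moreover have "(k * (m + 1) + 1) mod (m + 1) = 1"
      using \<open>m \<ge> 1\<close> by (subst mod_mult_self3) simp
    ultimately show ?thesis using \<open>m \<ge> 1\<close> by (intro exI[of _ m]) simp
  next
    case False
    with assms(3) have "s \<ge> 2" unfolding s_def by linarith
    with r have "r - (s - 1) = q * (m + 1) + 1" by linarith
    moreover have "(q * (m + 1) + 1) mod (m + 1) = 1"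
      using \<open>m \<ge> 1\<close> by (subst mod_mult_self3) simp
    moreover have "1 \<le> s - 1" "s - 1 \<le> m" "s - 1 \<le> r"
      using \<open>s \<ge> 2\<close> \<open>s \<le> m\<close> r by linarith+
    ultimately show ?thesis by (intro exI[of _ "s - 1"]) simp
  qed
qed

text \<open>The induction has to run over all states up to \<open>N\<close>, not only the status quo \<open>N\<close> itself,
  since the outcome of a state depends on the outcomes of everything reachable from it.\<close>

lemma misere_P_iff_mod_eq_one:
  assumes "m \<ge> 1" "r \<le> N"
  shows "misere_P m N r \<longleftrightarrow> r mod (m + 1) = 1"
  using assms(2)
proof (induction r rule: less_induct)
  case (less r)
  show ?case
  proof (cases "r = 0")
    case True
    then show ?thesis by (simp add: misere_zero)
  next
    case False
    then have "r \<ge> 1" by simp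
    have N_iff: "misere_N m N (r - d) \<longleftrightarrow> (r - d) mod (m + 1) \<noteq> 1" if "1 \<le> d" for d
    proof -
      have "misere_P m N (r - d) \<longleftrightarrow> (r - d) mod (m + 1) = 1"
        using that \<open>r \<ge> 1\<close> less.prems by (intro less.IH) auto
      moreover have "r - d \<in> states N"
        using less.prems by (auto simp: states_def)
      ultimately show ?thesis using misere_P_iff_not_N[of "r - d" N m] by metis
    qed
    have "misere_P m N r \<longleftrightarrow> (\<forall>r'. legal_move m N r r' \<longrightarrow> misere_N m N r')"
      using \<open>r \<ge> 1\<close> less.prems by (intro misere_P_iff) (auto simp: states_def)
    also have "\<dots> \<longleftrightarrow> (\<forall>d. 1 \<le> d \<and> d \<le> m \<and> d \<le> r \<longrightarrow> (r - d) mod (m + 1) \<noteq> 1)"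
      unfolding legal_move_iff[OF less.prems \<open>r \<ge> 1\<close>] using N_iff by metis
    also have "\<dots> \<longleftrightarrow> r mod (m + 1) = 1"
      using no_step_within_residue_one[of r m] step_into_residue_one[OF \<open>m \<ge> 1\<close> \<open>r \<ge> 1\<close>] by metis
    finally show ?thesis .
  qed
qed

theorem corollary4p2:
  fixes m N :: nat
  assumes "m \<ge> 1" and "N \<ge> 1"
  shows "misere_P m N (rung_state N 0) \<longleftrightarrow> [N = 1] (mod (m + 1))"
  using misere_P_iff_mod_eq_one[OF \<open>m \<ge> 1\<close>, of N N] \<open>m \<ge> 1\<close>
  by (simp add: rung_state_def cong_def)

end
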